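(* Let $\rho,\sigma,k>0$ be given, let $\alpha\neq 0$ be a real constant, let $x_0,y_0\in\mathbb{R}^n$, and let $c(t)$ be an arbitrary non-negative scalar function. Consider the game in $\mathbb{R}^n$ with one pursuer $P$ and one evader $E$ and dynamics $$P:\ \dot x(t)+\alpha x(t)=c(t)u(t),\quad x(0)=x_0,\qquad E:\ \dot y(t)+\alpha y(t)=c(t)v(t),\quad y(0)=y_0,$$ where the controls $u,v$ are measurable and satisfy the Gronwall-type constraints $$|u(t)|^2\le\rho^2+2k\int_0^t|u(s)|^2\,ds,\qquad |v(t)|^2\le\sigma^2+2k\int_0^t|v(s)|^2\,ds,\qquad t\ge 0.$$ If $\rho<\sigma$, then evasion is possible in this game; that is, there exists a strategy of the evader such that for any permissible control of the pursuer one has $x(t)\neq y(t)$ for all $t>0$.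
   Context: $|\cdot|$ is the Euclidean norm on $\mathbb{R}^n$. A measurable $\mathbb{R}^n$-valued function $u$ satisfying the first constraint above is called a permissible control of the pursuer, and a measurable $\mathbb{R}^n$-valued function $v$ satisfying the second is called a permissible control of the evader. Given permissible controls $u,v$, the trajectories are $$x(t)=x_0e^{-\alpha t}+\int_0^t e^{-\alpha(t-s)}c(s)u(s)\,ds,\qquad y(t)=y_0e^{-\alpha t}+\int_0^t e^{-\alpha(t-s)}c(s)v(s)\,ds.$$ A strategy of the evader is a function $V(x_0,y_0,t)$ such that, for any permissible control $u$ of the pursuer, the system $$\dot x(t)+\alpha x(t)=c(t)u(t),\ x(0)=x_0,\qquad \dot y(t)+\alpha y(t)=c(t)V(x_0,y_0,t),\ y(0)=y_0,$$ is uniquely solvable with solution $(x(t),y(t))$, and $$|V(x_0,y_0,t)|^2\le\sigma^2+2k\int_0^t|V(x_0,y_0,s)|^2\,ds.$$ The strategy is called permissible if every control it generates is permissible. In the conclusion, $(x(t),y(t))$ is the solution of this system.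
   Formalization: c is taken to be locally integrable (needed for the trajectories to exist), and if x_0 = y_0 it is assumed that the integral of c over [0,t] is positive for all t > 0; otherwise, e.g. for x_0 = y_0 and c = 0, x(t) = y(t) for all controls and the claim fails. *)

theory Defs
  imports "HOL-Analysis.Analysis"
begin

text \<open>Finiteness of the integral is part of the constraint, because \<^const>\<open>integral\<close> of a
  non-integrable function is 0.\<close>

definition gronwall_constraint :: "real \<Rightarrow> real \<Rightarrow> (real \<Rightarrow> real ^ 'n) \<Rightarrow> bool" where
  "gronwall_constraint k \<rho> u \<longleftrightarrow>
     (\<forall>t\<ge>0. (\<lambda>s. (norm (u s))\<^sup>2) integrable_on {0..t} \<and>
            (norm (u t))\<^sup>2 \<le> \<rho>\<^sup>2 + 2 * k * integral {0..t} (\<lambda>s. (norm (u s))\<^sup>2))"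

definition permissible_control :: "real \<Rightarrow> real \<Rightarrow> (real \<Rightarrow> real ^ 'n) \<Rightarrow> bool" where
  "permissible_control k \<rho> u \<longleftrightarrow>
     u \<in> borel_measurable (lebesgue_on {0..}) \<and> gronwall_constraint k \<rho> u"

text \<open>The usual \<open>\<epsilon>\<close>-\<open>\<delta>\<close> definition of absolute continuity; a division \<open>d\<close> of \<open>\<Union>d\<close> is
  a finite family of non-overlapping compact intervals \<open>K = {Inf K..Sup K}\<close>.\<close>

definition abs_continuous_on :: "real set \<Rightarrow> (real \<Rightarrow> 'a::real_normed_vector) \<Rightarrow> bool" where
  "abs_continuous_on S f \<longleftrightarrow>
     (\<forall>\<epsilon>>0. \<exists>\<delta>>0. \<forall>d. d division_of \<Union>d \<and> \<Union>d \<subseteq> S \<and> (\<Sum>K\<in>d. Sup K - Inf K) < \<delta> \<longrightarrow>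
        (\<Sum>K\<in>d. norm (f (Sup K) - f (Inf K))) < \<epsilon>)"

text \<open>Controls are only measurable, so the equation \<open>z' + \<alpha> z = c w\<close>, \<open>z 0 = z0\<close> on the half-line
  is understood in the sense of Caratheodory.\<close>

definition is_solution ::
  "real \<Rightarrow> (real \<Rightarrow> real) \<Rightarrow> real ^ 'n \<Rightarrow> (real \<Rightarrow> real ^ 'n) \<Rightarrow> (real \<Rightarrow> real ^ 'n) \<Rightarrow> bool" where
  "is_solution \<alpha> c z0 w z \<longleftrightarrow>
     (\<forall>T\<ge>0. abs_continuous_on {0..T} z) \<and> z 0 = z0 \<and>
     (AE t in lebesgue. t > 0 \<longrightarrow>
        (\<exists>z'. (z has_vector_derivative z') (at t) \<and> z' + \<alpha> *\<^sub>R z t = c t *\<^sub>R w t))"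

definition is_game_solution ::
  "real \<Rightarrow> (real \<Rightarrow> real) \<Rightarrow> real ^ 'n \<Rightarrow> real ^ 'n \<Rightarrow>
     (real \<Rightarrow> real ^ 'n) \<Rightarrow> (real \<Rightarrow> real ^ 'n) \<Rightarrow> (real \<Rightarrow> real ^ 'n) \<Rightarrow> (real \<Rightarrow> real ^ 'n) \<Rightarrow> bool" where
  "is_game_solution \<alpha> c x0 y0 u v x y \<longleftrightarrow> is_solution \<alpha> c x0 u x \<and> is_solution \<alpha> c y0 v y"

text \<open>Only times \<open>t \<ge> 0\<close> matter, so solutions are identified when they agree there.\<close>

definition uniquely_solvable ::
  "real \<Rightarrow> (real \<Rightarrow> real) \<Rightarrow> real ^ 'n \<Rightarrow> real ^ 'n \<Rightarrow>
     (real \<Rightarrow> real ^ 'n) \<Rightarrow> (real \<Rightarrow> real ^ 'n) \<Rightarrow> bool" where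
  "uniquely_solvable \<alpha> c x0 y0 u v \<longleftrightarrow>
     (\<exists>x y. is_game_solution \<alpha> c x0 y0 u v x y \<and>
        (\<forall>x' y'. is_game_solution \<alpha> c x0 y0 u v x' y' \<longrightarrow> (\<forall>t\<ge>0. x' t = x t \<and> y' t = y t)))"

definition evader_strategy ::
  "real \<Rightarrow> (real \<Rightarrow> real) \<Rightarrow> real \<Rightarrow> real \<Rightarrow> real \<Rightarrow>
     (real ^ 'n \<Rightarrow> real ^ 'n \<Rightarrow> real \<Rightarrow> real ^ 'n) \<Rightarrow> bool" where
  "evader_strategy \<alpha> c \<rho> \<sigma> k V \<longleftrightarrow>
     (\<forall>x0 y0. (\<forall>u. permissible_control k \<rho> u \<longrightarrow> uniquely_solvable \<alpha> c x0 y0 u (V x0 y0)) \<and>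
              gronwall_constraint k \<sigma> (V x0 y0))"

definition permissible_strategy ::
  "real \<Rightarrow> real \<Rightarrow> (real ^ 'n \<Rightarrow> real ^ 'n \<Rightarrow> real \<Rightarrow> real ^ 'n) \<Rightarrow> bool" where
  "permissible_strategy k \<sigma> V \<longleftrightarrow> (\<forall>x0 y0. permissible_control k \<sigma> (V x0 y0))"

end

theory Submission
  imports Defs
begin

text \<open>The evader moves in a constant unit direction \<open>e\<close> at the largest speed allowed,
  \<open>V t = \<sigma> exp (k t) e\<close>, where \<open>e\<close> points from \<open>x0\<close> to \<open>y0\<close> (any direction if they coincide); the
  constraint then holds with equality. By Gronwall's inequality the pursuer's control has norm at most
  \<open>\<rho> exp (k t) < \<sigma> exp (k t)\<close>, so \<open>p t = exp (\<alpha> t) (y t - x t) \<bullet> e\<close> has a nonnegative derivative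
  almost everywhere and, being absolutely continuous, is nondecreasing. If \<open>p 0 > 0\<close> then \<open>p\<close> stays
  positive. If \<open>x0 = y0\<close> and \<open>p t = 0\<close>, then \<open>p\<close> vanishes on \<open>{0..t}\<close>, which forces \<open>c = 0\<close> almost
  everywhere there, against the positivity of the integral of \<open>c\<close>.\<close>

subsection \<open>Absolutely continuous functions\<close>

lemma abs_continuous_on_subset:
  "abs_continuous_on S f \<Longrightarrow> T \<subseteq> S \<Longrightarrow> abs_continuous_on T f"
  unfolding abs_continuous_on_def by (meson order_trans)

text \<open>Every member of a division is a nonempty box contained in the divided set. This lets the
  endpoints \<open>Inf K\<close> and \<open>Sup K\<close> from the definition of absolute continuity
  be used as ordinary points of \<open>S\<close>.\<close>

lemma division_of_real_interval:
  fixes K :: "real set"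
  assumes "d division_of S" "K \<in> d"
  shows "K = {Inf K..Sup K}" "Inf K \<le> Sup K" "Inf K \<in> S" "Sup K \<in> S"
proof -
  obtain a b where K: "K = cbox a b" using division_ofD(4)[OF assms] by blast
  with division_ofD(3)[OF assms] have "a \<le> b" by auto
  then show "K = {Inf K..Sup K}" "Inf K \<le> Sup K" "Inf K \<in> S" "Sup K \<in> S"
    using division_ofD(2)[OF assms] unfolding K by auto
qed

lemma abs_continuous_onD:
  assumes "abs_continuous_on S f" "\<epsilon> > 0"
  obtains \<delta> where "\<delta> > 0"
    "\<And>d. d division_of \<Union>d \<Longrightarrow> \<Union>d \<subseteq> S \<Longrightarrow> (\<Sum>K\<in>d. Sup K - Inf K) < \<delta> \<Longrightarrow>
        (\<Sum>K\<in>d. norm (f (Sup K) - f (Inf K))) < \<epsilon>"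
proof -
  have "\<exists>\<delta>>0. \<forall>d. d division_of \<Union>d \<and> \<Union>d \<subseteq> S \<and>
      (\<Sum>K\<in>d. Sup K - Inf K) < \<delta> \<longrightarrow> (\<Sum>K\<in>d. norm (f (Sup K) - f (Inf K))) < \<epsilon>"
    using assms unfolding abs_continuous_on_def by simp
  then obtain \<delta> where "\<delta> > 0" and "\<forall>d. d division_of \<Union>d \<and> \<Union>d \<subseteq> S \<and>
      (\<Sum>K\<in>d. Sup K - Inf K) < \<delta> \<longrightarrow> (\<Sum>K\<in>d. norm (f (Sup K) - f (Inf K))) < \<epsilon>"
    by (elim exE conjE)
  then show thesis by (intro that[of \<delta>]) simp_all
qed

text \<open>The single interval between two points is already a division, so the
  \<open>\<delta>\<close> of absolute continuity serves for uniform continuity as well.\<close>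

lemma abs_continuous_on_imp_continuous_on:
  fixes f :: "real \<Rightarrow> 'a::real_normed_vector"
  assumes "abs_continuous_on {a..b} f"
  shows "continuous_on {a..b} f"
  unfolding continuous_on_iff
proof (intro ballI allI impI)
  fix x \<epsilon> :: real assume x: "x \<in> {a..b}" and "\<epsilon> > 0"
  then obtain \<delta> where "\<delta> > 0" and \<delta>: "\<And>d. d division_of \<Union>d \<Longrightarrow> \<Union>d \<subseteq> {a..b} \<Longrightarrow>
       (\<Sum>K\<in>d. Sup K - Inf K) < \<delta> \<Longrightarrow> (\<Sum>K\<in>d. norm (f (Sup K) - f (Inf K))) < \<epsilon>"
    using abs_continuous_onD[OF assms] by blast
  have step: "norm (f v - f u) < \<epsilon>" if "u \<in> {a..b}" "v \<in> {a..b}" "u \<le> v" "v - u < \<delta>" for u v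
  proof -
    have "{{u..v}} division_of \<Union>{{u..v}}"
      using division_of_self[of u v] that by simp
    then show ?thesis
      using \<delta>[of "{{u..v}}"] that by simp
  qed
  show "\<exists>d>0. \<forall>x'\<in>{a..b}. dist x' x < d \<longrightarrow> dist (f x') (f x) < \<epsilon>"
  proof (intro exI[of _ \<delta>] conjI ballI impI)
    fix y assume y: "y \<in> {a..b}" "dist y x < \<delta>"
    show "dist (f y) (f x) < \<epsilon>"
      using step[of x y] step[of y x] x y
      by (cases "x \<le> y") (auto simp: dist_norm norm_minus_commute)
  qed fact
qed

text \<open>Summing the increment bound over a division transfers smallness of the variations of
  \<open>f\<close> and \<open>g\<close> to \<open>h\<close>. Differences, inner products, products
  and Lipschitz functions are all handled through this comparison.\<close>

lemma abs_continuous_on_bound: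
  fixes f :: "real \<Rightarrow> 'a::real_normed_vector" and g :: "real \<Rightarrow> 'b::real_normed_vector"
    and h :: "real \<Rightarrow> 'c::real_normed_vector"
  assumes f: "abs_continuous_on S f" and g: "abs_continuous_on S g" and "B \<ge> 0"
    and h: "\<And>u v. u \<in> S \<Longrightarrow> v \<in> S \<Longrightarrow> norm (h v - h u) \<le> B * (norm (f v - f u) + norm (g v - g u))"
  shows "abs_continuous_on S h"
  unfolding abs_continuous_on_def
proof (intro allI impI)
  fix \<epsilon> :: real assume "\<epsilon> > 0"
  \<comment> \<open>The factor 2 accounts for the two variations, and \<open>B + 1\<close> in place
    of \<open>B\<close> keeps the quotient meaningful when \<open>B = 0\<close>.\<close>
  define \<eta> where "\<eta> = \<epsilon> / (2 * (B + 1))"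
  have "\<eta> > 0" using \<open>\<epsilon> > 0\<close> \<open>B \<ge> 0\<close> by (simp add: \<eta>_def)
  obtain \<delta>1 where "\<delta>1 > 0" and \<delta>1: "\<And>d. d division_of \<Union>d \<Longrightarrow> \<Union>d \<subseteq> S \<Longrightarrow>
       (\<Sum>K\<in>d. Sup K - Inf K) < \<delta>1 \<Longrightarrow> (\<Sum>K\<in>d. norm (f (Sup K) - f (Inf K))) < \<eta>"
    using abs_continuous_onD[OF f \<open>\<eta> > 0\<close>] by blast
  obtain \<delta>2 where "\<delta>2 > 0" and \<delta>2: "\<And>d. d division_of \<Union>d \<Longrightarrow> \<Union>d \<subseteq> S \<Longrightarrow>
       (\<Sum>K\<in>d. Sup K - Inf K) < \<delta>2 \<Longrightarrow> (\<Sum>K\<in>d. norm (g (Sup K) - g (Inf K))) < \<eta>"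
    using abs_continuous_onD[OF g \<open>\<eta> > 0\<close>] by blast
  show "\<exists>\<delta>>0. \<forall>d. d division_of \<Union>d \<and> \<Union>d \<subseteq> S \<and> (\<Sum>K\<in>d. Sup K - Inf K) < \<delta> \<longrightarrow>
          (\<Sum>K\<in>d. norm (h (Sup K) - h (Inf K))) < \<epsilon>"
  proof (intro exI[of _ "min \<delta>1 \<delta>2"] conjI allI impI, goal_cases)
    case 1 then show ?case using \<open>\<delta>1 > 0\<close> \<open>\<delta>2 > 0\<close> by simp
  next
    case (2 d)
    have mem: "Inf K \<in> S" "Sup K \<in> S" if "K \<in> d" for K
      using division_of_real_interval(3,4)[of d "\<Union>d" K] 2 that by auto
    have "(\<Sum>K\<in>d. norm (h (Sup K) - h (Inf K)))
        \<le> (\<Sum>K\<in>d. B * (norm (f (Sup K) - f (Inf K)) + norm (g (Sup K) - g (Inf K))))"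
      by (intro sum_mono h mem)
    also have "\<dots> = B * ((\<Sum>K\<in>d. norm (f (Sup K) - f (Inf K))) + (\<Sum>K\<in>d. norm (g (Sup K) - g (Inf K))))"
      by (simp only: sum_distrib_left[symmetric] sum.distrib)
    also have "\<dots> \<le> B * (\<eta> + \<eta>)"
      using \<delta>1[of d] \<delta>2[of d] 2 \<open>B \<ge> 0\<close> by (intro mult_left_mono add_mono) auto
    also have "\<dots> < (B + 1) * (\<eta> + \<eta>)"
      using \<open>\<eta> > 0\<close> by (intro mult_strict_right_mono) auto
    also have "\<dots> = \<epsilon>"
      using \<open>B \<ge> 0\<close> unfolding \<eta>_def by (simp add: divide_simps)
    finally show ?case .
  qed
qed

lemma abs_continuous_on_diff:
  assumes "abs_continuous_on S f" "abs_continuous_on S g"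
  shows "abs_continuous_on S (\<lambda>t. f t - g t)"
proof (rule abs_continuous_on_bound[OF assms, where B = 1])
  fix u v
  have "(f v - g v) - (f u - g u) = (f v - f u) - (g v - g u)"
    by (simp add: algebra_simps)
  then show "norm ((f v - g v) - (f u - g u)) \<le> 1 * (norm (f v - f u) + norm (g v - g u))"
    using norm_triangle_ineq4[of "f v - f u" "g v - g u"] by (simp only: mult_1)
qed simp

lemma abs_continuous_on_inner_right:
  fixes f :: "real \<Rightarrow> 'a::real_inner"
  assumes "abs_continuous_on S f"
  shows "abs_continuous_on S (\<lambda>t. f t \<bullet> b)"
proof (rule abs_continuous_on_bound[OF assms assms, where B = "norm b"])
  fix u v
  have "norm (f v \<bullet> b - f u \<bullet> b) \<le> norm (f v - f u) * norm b"
    using Cauchy_Schwarz_ineq2[of "f v - f u" b] by (simp add: inner_diff_left)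
  also have "\<dots> \<le> norm b * (norm (f v - f u) + norm (f v - f u))"
    by (simp add: mult_right_mono algebra_simps)
  finally show "norm (f v \<bullet> b - f u \<bullet> b) \<le> norm b * (norm (f v - f u) + norm (f v - f u))" .
qed simp

lemma abs_continuous_on_add_const:
  "abs_continuous_on S f \<Longrightarrow> abs_continuous_on S (\<lambda>t. c + f t)"
  by (simp add: abs_continuous_on_def)

text \<open>Both factors are continuous on a compact interval, hence bounded there, and the usual
  splitting of the increment of a product is then dominated by the increments of the
  factors.\<close>

lemma abs_continuous_on_scaleR:
  fixes f :: "real \<Rightarrow> real" and g :: "real \<Rightarrow> 'a::real_normed_vector"
  assumes f: "abs_continuous_on {a..b} f" and g: "abs_continuous_on {a..b} g"
  shows "abs_continuous_on {a..b} (\<lambda>t. f t *\<^sub>R g t)"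
proof -
  have bnd: "\<exists>B>0. \<forall>t\<in>{a..b}. norm (h t) \<le> B" if "abs_continuous_on {a..b} h"
    for h :: "real \<Rightarrow> 'c::real_normed_vector"
    using compact_imp_bounded[OF compact_continuous_image[OF
        abs_continuous_on_imp_continuous_on[OF that] compact_Icc]]
    by (auto simp: bounded_pos)
  obtain A where "A > 0" and A: "\<And>t. t \<in> {a..b} \<Longrightarrow> norm (f t) \<le> A" using bnd[OF f] by blast
  obtain B where "B > 0" and B: "\<And>t. t \<in> {a..b} \<Longrightarrow> norm (g t) \<le> B" using bnd[OF g] by blast
  show ?thesis
  proof (rule abs_continuous_on_bound[OF f g, where B = "A + B"])
    fix u v assume uv: "u \<in> {a..b}" "v \<in> {a..b}"
    have "f v *\<^sub>R g v - f u *\<^sub>R g u = (f v - f u) *\<^sub>R g u + f v *\<^sub>R (g v - g u)"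
      by (simp add: algebra_simps)
    then have "norm (f v *\<^sub>R g v - f u *\<^sub>R g u) \<le> norm (f v - f u) * norm (g u) + norm (f v) * norm (g v - g u)"
      by (metis norm_triangle_ineq norm_scaleR real_norm_def)
    also have "\<dots> \<le> norm (f v - f u) * (A + B) + (A + B) * norm (g v - g u)"
      using A[OF uv(2)] B[OF uv(1)] \<open>A > 0\<close> \<open>B > 0\<close>
      by (intro add_mono mult_left_mono mult_right_mono) auto
    finally show "norm (f v *\<^sub>R g v - f u *\<^sub>R g u) \<le> (A + B) * (norm (f v - f u) + norm (g v - g u))"
      by (simp add: algebra_simps)
  qed (use \<open>A > 0\<close> \<open>B > 0\<close> in auto)
qed

lemma abs_continuous_on_indefinite_integral:
  fixes f :: "real \<Rightarrow> 'a::euclidean_space"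
  assumes f: "f absolutely_integrable_on {a..b}"
  shows "abs_continuous_on {a..b} (\<lambda>t. integral {a..t} f)"
  unfolding abs_continuous_on_def
proof (intro allI impI)
  fix \<epsilon> :: real assume "\<epsilon> > 0"
  \<comment> \<open>Split \<open>|f|\<close> at a level \<open>n\<close>: the excess over \<open>n\<close> has small integral, the rest is at most \<open>n\<close>
    times the length.\<close>
  define g where "g x = norm (f x)" for x
  define h where "h n x = min (g x) (real n)" for n x
  have g: "g absolutely_integrable_on {a..b}"
    unfolding g_def by (rule absolutely_integrable_norm[OF f, unfolded o_def])
  have hm: "h n absolutely_integrable_on {a..b}" for n
    unfolding h_def by (intro absolutely_integrable_min_1 g) auto
  \<comment> \<open>At each point the truncation equals \<open>g\<close> as soon as \<open>n\<close>
    exceeds \<open>g x\<close>, and \<open>g\<close> itself dominates all truncations.\<close>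
  have "(\<lambda>n. integral {a..b} (h n)) \<longlonglongrightarrow> integral {a..b} g"
  proof (rule dominated_convergence(2)[where h = g])
    show "(\<lambda>n. h n x) \<longlonglongrightarrow> g x" for x
    proof (rule tendsto_eventually)
      obtain N :: nat where "g x \<le> real N" using real_arch_simple by blast
      then have "h n x = g x" if "n \<ge> N" for n
        using that of_nat_mono[OF that, where 'a = real] by (simp add: h_def)
      then show "eventually (\<lambda>n. h n x = g x) sequentially"
        using eventually_sequentially by blast
    qed
  qed (use hm g in \<open>auto simp: h_def g_def absolutely_integrable_on_def\<close>)
  then obtain n where n: "\<bar>integral {a..b} (h n) - integral {a..b} g\<bar> < \<epsilon> / 2"
    using \<open>\<epsilon> > 0\<close> unfolding LIMSEQ_iff by (metis half_gt_zero order_refl real_norm_def)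
  have gi: "g integrable_on {u..v}" and hi: "h n integrable_on {u..v}" if "{u..v} \<subseteq> {a..b}" for u v
    using that g hm[of n] absolutely_integrable_on_subinterval absolutely_integrable_on_def by blast+
  show "\<exists>\<delta>>0. \<forall>d. d division_of \<Union>d \<and> \<Union>d \<subseteq> {a..b} \<and> (\<Sum>K\<in>d. Sup K - Inf K) < \<delta> \<longrightarrow>
          (\<Sum>K\<in>d. norm (integral {a..Sup K} f - integral {a..Inf K} f)) < \<epsilon>"
  \<comment> \<open>With this \<open>\<delta>\<close> the part of height at most \<open>n\<close>
    contributes at most \<open>\<epsilon> / 2\<close>; adding 1 covers \<open>n = 0\<close>.\<close>
  proof (intro exI[of _ "\<epsilon> / (2 * (real n + 1))"] conjI allI impI, goal_cases)
    case 1 then show ?case using \<open>\<epsilon> > 0\<close> by simp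
  next
    case (2 d)
    let ?r = "\<lambda>x. g x - h n x"
    have K: "K = {Inf K..Sup K}" "Inf K \<le> Sup K" if "K \<in> d" for K
      using division_of_real_interval[of d "\<Union>d" K] 2 that by blast+
    have Kab: "a \<le> Inf K" "Sup K \<le> b" if "K \<in> d" for K
      using division_of_real_interval(3,4)[of d "\<Union>d" K] 2 that by auto
    have le: "norm (integral {a..Sup K} f - integral {a..Inf K} f) \<le> integral K ?r + real n * (Sup K - Inf K)"
      if "K \<in> d" for K
    proof -
      let ?u = "Inf K" and ?v = "Sup K"
      note ab = Kab[OF that]
      have sub: "{?u..?v} \<subseteq> {a..b}" using ab by simp
      have fi: "f absolutely_integrable_on {?u..?v}"
        using f sub absolutely_integrable_on_subinterval by blast
      have fav: "f integrable_on {a..?v}"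
        using absolutely_integrable_on_subinterval[OF f, of a ?v] ab absolutely_integrable_on_def by auto
      have "integral {a..?v} f - integral {a..?u} f = integral {?u..?v} f"
        using Henstock_Kurzweil_Integration.integral_combine[OF ab(1) K(2)[OF that] fav]
        by (simp add: algebra_simps)
      then have "norm (integral {a..?v} f - integral {a..?u} f) \<le> integral {?u..?v} g"
        unfolding g_def using fi absolutely_integrable_on_def
        by (auto intro: integral_norm_bound_integral)
      also have "\<dots> = integral {?u..?v} ?r + integral {?u..?v} (h n)"
        by (subst Henstock_Kurzweil_Integration.integral_diff[OF gi[OF sub] hi[OF sub]]) simp
      also have "integral {?u..?v} (h n) \<le> integral {?u..?v} (\<lambda>x. real n)"
        by (rule integral_le[OF hi[OF sub]]) (auto simp: h_def)
      also have "integral {?u..?v} (\<lambda>x. real n) = real n * (?v - ?u)"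
        using K(2)[OF that] by simp
      finally show ?thesis using K(1)[OF that] by simp
    qed
    have ri: "?r integrable_on {a..b}" by (intro integrable_diff gi hi) auto
    have riU: "?r integrable_on \<Union>d"
      using integrable_on_subdivision[OF _ ri] 2 by blast
    \<comment> \<open>The excess \<open>?r\<close> is nonnegative and the intervals do not overlap,
      so its total over the division is bounded by its integral over \<open>{a..b}\<close>, however
      many intervals there are.\<close>
    have "(\<Sum>K\<in>d. integral K ?r) = integral (\<Union>d) ?r"
      using 2 by (intro integral_combine_division_topdown[symmetric] riU) auto
    also have "\<dots> \<le> integral {a..b} ?r"
      using 2 by (intro integral_subset_le riU ri) (auto simp: h_def)
    also have "\<dots> < \<epsilon> / 2"
      using n Henstock_Kurzweil_Integration.integral_diff[OF gi[OF order_refl] hi[OF order_refl]]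
      by linarith
    finally have 3: "(\<Sum>K\<in>d. integral K ?r) < \<epsilon> / 2" .
    have 4: "real n * (\<Sum>K\<in>d. Sup K - Inf K) \<le> \<epsilon> / 2"
    proof -
      have "real n * (\<Sum>K\<in>d. Sup K - Inf K) \<le> real n * (\<epsilon> / (2 * (real n + 1)))"
        using 2 by (intro mult_left_mono) auto
      also have "\<dots> \<le> \<epsilon> / 2"
        using \<open>\<epsilon> > 0\<close> by (simp add: field_simps)
      finally show ?thesis .
    qed
    have "(\<Sum>K\<in>d. norm (integral {a..Sup K} f - integral {a..Inf K} f))
        \<le> (\<Sum>K\<in>d. integral K ?r + real n * (Sup K - Inf K))"
      by (rule sum_mono[OF le])
    then show ?case using 3 4 by (simp add: sum.distrib sum_distrib_left)
  qed
qed

text \<open>The variation of the identity over a division is the total length, so for the identity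
  \<open>\<epsilon>\<close> itself serves as \<open>\<delta>\<close>. The Lipschitz bound compares
  \<open>f\<close> with the identity, which fills both slots of the comparison lemma.\<close>

lemma abs_continuous_on_lipschitz:
  fixes f :: "real \<Rightarrow> 'a::real_normed_vector"
  assumes "L-lipschitz_on S f"
  shows "abs_continuous_on S f"
proof (rule abs_continuous_on_bound[where f = "\<lambda>t. t" and g = "\<lambda>t. t" and B = L])
  show "abs_continuous_on S (\<lambda>t. t)"
    unfolding abs_continuous_on_def
  proof (intro allI impI)
    fix \<epsilon> :: real assume "\<epsilon> > 0"
    have "(\<Sum>K\<in>d. norm (Sup K - Inf K)) = (\<Sum>K\<in>d. Sup K - Inf K)"
      if "d division_of \<Union>d" for d :: "real set set"
      by (intro sum.cong refl) (use division_of_real_interval(2)[OF that] in auto)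
    with \<open>\<epsilon> > 0\<close> show "\<exists>\<delta>>0. \<forall>d. d division_of \<Union>d \<and> \<Union>d \<subseteq> S \<and> (\<Sum>K\<in>d. Sup K - Inf K) < \<delta> \<longrightarrow>
        (\<Sum>K\<in>d. norm (Sup K - Inf K)) < \<epsilon>" by auto
  qed
  then show "abs_continuous_on S (\<lambda>t. t)" .
  show "L \<ge> 0" using assms lipschitz_on_nonneg by blast
  then show "norm (f v - f u) \<le> L * (norm (v - u) + norm (v - u))" if "u \<in> S" "v \<in> S" for u v
    using lipschitz_onD[OF assms that(2,1)] mult_nonneg_nonneg[of L "\<bar>v - u\<bar>"]
    unfolding dist_norm real_norm_def distrib_left by linarith
qed

lemma abs_continuous_on_exp:
  "abs_continuous_on {a..b} (\<lambda>t::real. exp (\<alpha> * t))"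
proof (rule abs_continuous_on_lipschitz, rule bounded_derivative_imp_lipschitz)
  show "((\<lambda>t. exp (\<alpha> * t)) has_derivative (\<lambda>h. \<alpha> * exp (\<alpha> * t) * h)) (at t within {a..b})" for t
    by (auto intro!: derivative_eq_intros)
  \<comment> \<open>Since \<open>\<bar>t\<bar>\<close> is at most
    \<open>max \<bar>a\<bar> \<bar>b\<bar>\<close>, this constant works for either sign of
    \<open>\<alpha>\<close> and of the endpoints.\<close>
  show "onorm (\<lambda>h. \<alpha> * exp (\<alpha> * t) * h) \<le> \<bar>\<alpha>\<bar> * exp (\<bar>\<alpha>\<bar> * max \<bar>a\<bar> \<bar>b\<bar>)" if "t \<in> {a..b}" for t
  proof (rule onorm_le)
    fix h :: real
    have "\<alpha> * t \<le> \<bar>\<alpha>\<bar> * \<bar>t\<bar>" by (metis abs_ge_self abs_mult)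
    also have "\<dots> \<le> \<bar>\<alpha>\<bar> * max \<bar>a\<bar> \<bar>b\<bar>" using that by (intro mult_left_mono) auto
    finally show "norm (\<alpha> * exp (\<alpha> * t) * h) \<le> \<bar>\<alpha>\<bar> * exp (\<bar>\<alpha>\<bar> * max \<bar>a\<bar> \<bar>b\<bar>) * norm h"
      by (simp add: abs_mult mult_left_mono mult_right_mono)
  qed
qed auto

text \<open>Absolute continuity makes the null set of exceptional points harmless; the negative of
  the Cantor function shows that continuity alone would not do. The increment of \<open>f\<close> is
  telescoped over a fine tagged division, whose intervals are separated according to whether the tag
  is exceptional.\<close>

lemma abs_continuous_on_mono:
  fixes f :: "real \<Rightarrow> real"
  assumes "a \<le> b" and ac: "abs_continuous_on {a..b} f"
    and deriv: "AE t in lebesgue. a < t \<and> t < b \<longrightarrow> (\<exists>f'\<ge>0. (f has_real_derivative f') (at t))"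
  shows "f a \<le> f b"
proof (rule field_le_epsilon)
  fix \<epsilon>0 :: real assume "\<epsilon>0 > 0"
  \<comment> \<open>The regular intervals will cost at most \<open>\<epsilon> * (b - a)\<close> and
    the exceptional ones at most \<open>\<epsilon>\<close>, which together make
    \<open>\<epsilon>0\<close>.\<close>
  define \<epsilon> where "\<epsilon> = \<epsilon>0 / (b - a + 1)"
  have "\<epsilon> > 0" using \<open>\<epsilon>0 > 0\<close> \<open>a \<le> b\<close> by (simp add: \<epsilon>_def)
  \<comment> \<open>The endpoints are put into \<open>N\<close> because the derivative is only
    assumed to exist inside the interval.\<close>
  define N where "N = {t \<in> {a..b}. \<not> (a < t \<and> t < b \<and> (\<exists>f'\<ge>0. (f has_real_derivative f') (at t)))}"
  obtain M where "negligible M" and M: "\<And>t. t \<notin> M \<Longrightarrow> a < t \<and> t < b \<longrightarrow> (\<exists>f'\<ge>0. (f has_real_derivative f') (at t))"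
    using deriv unfolding eventually_ae_filter_negligible by blast
  have "N \<subseteq> insert a (insert b M)"
    using M unfolding N_def by force
  then have "negligible N"
    using \<open>negligible M\<close> negligible_subset by (metis negligible_insert)
  obtain \<delta> where "\<delta> > 0" and \<delta>: "\<And>d. d division_of \<Union>d \<Longrightarrow> \<Union>d \<subseteq> {a..b} \<Longrightarrow>
       (\<Sum>K\<in>d. Sup K - Inf K) < \<delta> \<Longrightarrow> (\<Sum>K\<in>d. norm (f (Sup K) - f (Inf K))) < \<epsilon>"
    using abs_continuous_onD[OF ac \<open>\<epsilon> > 0\<close>] by blast
  \<comment> \<open>Outer regularity bounds \<open>G - N\<close>; as \<open>N\<close> is null,
    \<open>G\<close> itself then has measure below \<open>\<delta>\<close>.\<close>
  obtain G where "open G" "N \<subseteq> G" and G: "G - N \<in> lmeasurable" "emeasure lebesgue (G - N) < ennreal \<delta>"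
    using sets_lebesgue_outer_open[OF negligible_imp_sets[OF \<open>negligible N\<close>] \<open>\<delta> > 0\<close>] by blast
  have GN: "measure lebesgue (G - N) < \<delta>"
    using G \<open>\<delta> > 0\<close> by (simp add: emeasure_eq_measure2 ennreal_less_iff)
  have Gm: "G \<in> lmeasurable" and Gd: "measure lebesgue G < \<delta>"
  proof -
    have sd: "negligible (sym_diff (G - N) G)"
      by (rule negligible_subset[OF \<open>negligible N\<close>]) auto
    show "G \<in> lmeasurable" using lmeasurable_negligible_symdiff[OF G(1) sd] .
    show "measure lebesgue G < \<delta>"
      using measure_negligible_symdiff[OF G(1) sd] GN by simp
  qed
  \<comment> \<open>This is a straddle estimate: when \<open>t\<close> lies between \<open>u\<close>
    and \<open>v\<close>, the linear approximation errors on the two sides add up to at most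
    \<open>\<epsilon> * (v - u)\<close>, and the linear part \<open>f' * (v - u)\<close> is
    nonnegative.\<close>
  have "\<exists>r>0. \<forall>u v. u \<le> t \<and> t \<le> v \<and> u \<in> ball t r \<and> v \<in> ball t r \<longrightarrow> - (\<epsilon> * (v - u)) \<le> f v - f u"
    if t: "t \<in> {a..b} - N" for t
  proof -
    obtain f' where "f' \<ge> 0" and "(f has_real_derivative f') (at t)"
      using t unfolding N_def by auto
    then obtain r where "r > 0" and
      r: "\<And>y. \<bar>y - t\<bar> < r \<Longrightarrow> \<bar>f y - f t - f' * (y - t)\<bar> \<le> \<epsilon> * \<bar>y - t\<bar>"
      using \<open>\<epsilon> > 0\<close> unfolding has_field_derivative_def has_derivative_at_alt by (auto simp: real_norm_def)
    have "- (\<epsilon> * (v - u)) \<le> f v - f u" if "u \<le> t" "t \<le> v" "u \<in> ball t r" "v \<in> ball t r" for u v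
    proof -
      have "\<bar>f v - f t - f' * (v - t)\<bar> \<le> \<epsilon> * (v - t)" "\<bar>f u - f t - f' * (u - t)\<bar> \<le> \<epsilon> * (t - u)"
        using r[of v] r[of u] that by (auto simp: dist_real_def)
      moreover have "f' * (v - t) \<ge> 0" "f' * (t - u) \<ge> 0"
        using \<open>f' \<ge> 0\<close> that by auto
      ultimately show ?thesis by (simp add: algebra_simps)
    qed
    with \<open>r > 0\<close> show ?thesis by blast
  qed
  then obtain r where rpos: "\<And>t. t \<in> {a..b} - N \<Longrightarrow> r t > 0"
    and r: "\<And>t u v. t \<in> {a..b} - N \<Longrightarrow> u \<le> t \<Longrightarrow> t \<le> v \<Longrightarrow> u \<in> ball t (r t) \<Longrightarrow> v \<in> ball t (r t) \<Longrightarrow>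
      - (\<epsilon> * (v - u)) \<le> f v - f u"
    by metis
  \<comment> \<open>Intervals tagged in the null set \<open>N\<close> stay inside the small open set \<open>G\<close>, where absolute continuity
    controls the variation; on the others the derivative at the tag bounds the decrease.\<close>
  define \<gamma> where "\<gamma> t = (if t \<in> N then G else if t \<in> {a..b} then ball t (r t) else ball t 1)" for t
  have "gauge \<gamma>"
    using \<open>open G\<close> \<open>N \<subseteq> G\<close> rpos by (auto simp: gauge_def \<gamma>_def)
  then obtain p where p: "p tagged_division_of {a..b}" "\<gamma> fine p"
    using fine_division_exists_real by blast
  have "finite p" using tagged_division_ofD(1)[OF p(1)] .
  define q where "q = {(t, K) \<in> p. t \<in> N}"
  have "q \<subseteq> p" by (auto simp: q_def)
  have K: "K = {Inf K..Sup K}" "Inf K \<le> t" "t \<le> Sup K" "t \<in> {a..b}" "Inf K \<in> K" "Sup K \<in> K"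
    if "(t, K) \<in> p" for t K
  proof -
    have "\<exists>u v. K = cbox u v" using tagged_division_ofD(4)[OF p(1) that] .
    then obtain u v where "K = cbox u v" by blast
    moreover have "t \<in> K" "K \<subseteq> {a..b}" using tagged_division_ofD(2,3)[OF p(1) that] by auto
    ultimately show "K = {Inf K..Sup K}" "Inf K \<le> t" "t \<le> Sup K" "t \<in> {a..b}" "Inf K \<in> K" "Sup K \<in> K"
      by auto
  qed
  have pos: "0 \<le> \<epsilon> * (Sup K - Inf K)" if "(t, K) \<in> p" for t K
    using K(2,3)[OF that] \<open>\<epsilon> > 0\<close> by (intro mult_nonneg_nonneg) auto
  have good: "- (\<Sum>(t, K)\<in>p - q. f (Sup K) - f (Inf K)) \<le> \<epsilon> * (b - a)"
  proof -
    have "- (\<Sum>(t, K)\<in>p - q. f (Sup K) - f (Inf K)) \<le> (\<Sum>(t, K)\<in>p - q. \<epsilon> * (Sup K - Inf K))"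
      unfolding sum_negf[symmetric]
    proof (rule sum_mono, clarify)
      fix t K assume tK: "(t, K) \<in> p" "(t, K) \<notin> q"
      then have "t \<notin> N" by (simp add: q_def)
      then have "K \<subseteq> ball t (r t)"
        using fineD[OF p(2) tK(1)] K(4)[OF tK(1)] by (simp add: \<gamma>_def)
      then show "- (f (Sup K) - f (Inf K)) \<le> \<epsilon> * (Sup K - Inf K)"
        using r[of t "Inf K" "Sup K"] K[OF tK(1)] \<open>t \<notin> N\<close> by force
    qed
    also have "\<dots> \<le> (\<Sum>(t, K)\<in>p. \<epsilon> * (Sup K - Inf K))"
      using \<open>finite p\<close> \<open>\<epsilon> > 0\<close> by (intro sum_mono2) (auto intro: pos)
    also have "\<dots> = \<epsilon> * (b - a)"
      using additive_tagged_division_1[OF \<open>a \<le> b\<close> p(1), of "\<lambda>t. \<epsilon> * t"] by (simp add: right_diff_distrib)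
    finally show ?thesis .
  qed
  have bad: "- (\<Sum>(t, K)\<in>q. f (Sup K) - f (Inf K)) \<le> \<epsilon>"
  proof -
    let ?d = "snd ` q"
    have q: "q tagged_partial_division_of {a..b}"
      using p(1) \<open>q \<subseteq> p\<close> tagged_partial_division_subset unfolding tagged_division_of_def by blast
    have d: "?d division_of \<Union>?d" by (rule partial_division_of_tagged_division[OF q])
    have dab: "\<Union>?d \<subseteq> {a..b}"
      using tagged_partial_division_ofD(3)[OF q] by fastforce
    have dG: "\<Union>?d \<subseteq> G"
      using fineD[OF p(2)] \<open>q \<subseteq> p\<close> by (fastforce simp: q_def \<gamma>_def)
    \<comment> \<open>The total length of the exceptional intervals is the measure of their union.
      That union lies in \<open>G\<close>, so the length condition of absolute continuity is
      met.\<close>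
    have "(\<Sum>K\<in>?d. Sup K - Inf K) = (\<Sum>K\<in>?d. integral K (\<lambda>_. 1))"
    proof (rule sum.cong[OF refl])
      fix K assume "K \<in> ?d"
      then obtain u v :: real where "K = {u..v}" "u \<le> v"
        using division_of_real_interval[OF d] by metis
      then show "Sup K - Inf K = integral K (\<lambda>_. 1)" by simp
    qed
    also have "\<dots> = integral (\<Union>?d) (\<lambda>_. 1)"
    proof (rule integral_combine_division_bottomup[OF d, symmetric])
      fix K assume "K \<in> ?d"
      then obtain u v :: real where "K = {u..v}"
        using division_of_real_interval[OF d] by metis
      then show "(\<lambda>_. 1 :: real) integrable_on K" by (simp add: integrable_const_ivl)
    qed
    also have "\<dots> = measure lebesgue (\<Union>?d)"
      using lmeasurable_division[OF d] by (simp add: lmeasure_integral)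
    also have "\<dots> \<le> measure lebesgue G"
      using lmeasurable_division[OF d] Gm dG by (intro measure_mono_fmeasurable) auto
    also have "\<dots> < \<delta>" by (fact Gd)
    finally have "(\<Sum>K\<in>?d. norm (f (Sup K) - f (Inf K))) < \<epsilon>"
      by (rule \<delta>[OF d dab])
    \<comment> \<open>Two tagged pairs can share an interval only if it is degenerate, where the
      increment of \<open>f\<close> is zero. Forgetting the tags therefore leaves the sum
      unchanged.\<close>
    moreover have "(\<Sum>(t, K)\<in>q. norm (f (Sup K) - f (Inf K))) = (\<Sum>K\<in>?d. norm (f (Sup K) - f (Inf K)))"
    proof -
      \<comment> \<open>\<open>Sup {}\<close> and \<open>Inf {}\<close> are unspecified reals, so the empty interval needs its own case.\<close>
      define D where "D K = (if K = {} then 0 else norm (f (Sup K) - f (Inf K)))" for K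
      have D: "norm (f (Sup K) - f (Inf K)) = D K" if "(t, K) \<in> q" for t K
        using K(5)[of t K] \<open>q \<subseteq> p\<close> that by (auto simp: D_def)
      have "(\<Sum>(t, K)\<in>q. D K) = (\<Sum>K\<in>?d. D K)"
      proof (rule sum.over_tagged_division_lemma[OF tagged_partial_division_of_Union_self[OF q]])
        show "D (cbox u v) = 0" if "box u v = {}" for u v
          using that by (auto simp: D_def)
      qed
      moreover have "(\<Sum>(t, K)\<in>q. norm (f (Sup K) - f (Inf K))) = (\<Sum>(t, K)\<in>q. D K)"
        by (rule sum.cong) (auto simp: D simp del: real_norm_def)
      moreover have "(\<Sum>K\<in>?d. norm (f (Sup K) - f (Inf K))) = (\<Sum>K\<in>?d. D K)"
        by (rule sum.cong) (auto simp: D simp del: real_norm_def)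
      ultimately show ?thesis by simp
    qed
    moreover have "- (\<Sum>(t, K)\<in>q. f (Sup K) - f (Inf K)) \<le> (\<Sum>(t, K)\<in>q. norm (f (Sup K) - f (Inf K)))"
      unfolding sum_negf[symmetric] by (rule sum_mono) auto
    ultimately show ?thesis by linarith
  qed
  have "f b - f a = (\<Sum>(t, K)\<in>p. f (Sup K) - f (Inf K))"
    by (rule additive_tagged_division_1[OF \<open>a \<le> b\<close> p(1), symmetric])
  also have "\<dots> = (\<Sum>(t, K)\<in>p - q. f (Sup K) - f (Inf K)) + (\<Sum>(t, K)\<in>q. f (Sup K) - f (Inf K))"
    by (rule sum.subset_diff[OF \<open>q \<subseteq> p\<close> \<open>finite p\<close>])
  finally have "f a - f b \<le> \<epsilon> * (b - a) + \<epsilon>" using good bad by linarith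
  also have "\<dots> = \<epsilon> * (b - a + 1)" by (simp add: algebra_simps)
  also have "\<dots> = \<epsilon>0" using \<open>a \<le> b\<close> by (simp add: \<epsilon>_def)
  finally show "f a \<le> f b + \<epsilon>0" by simp
qed

lemma indefinite_integral_has_vector_derivative_AE:
  fixes f :: "real \<Rightarrow> 'a::euclidean_space"
  assumes f: "\<And>a b. f integrable_on {a..b}"
  shows "AE t in lebesgue. a < t \<longrightarrow> ((\<lambda>t. integral {a..t} f) has_vector_derivative f t) (at t)"
proof -
  \<comment> \<open>The library provides right derivatives almost everywhere; reflection gives the left ones.\<close>
  have f': "(\<lambda>x. f (- x)) integrable_on {a..b}" for a b
    using f[of "-b" "-a"] Henstock_Kurzweil_Integration.integrable_reflect_real[where f = f and a = "-b" and b = "-a"] by simp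
  obtain N where N: "negligible N" "\<And>x e. x \<notin> N \<Longrightarrow> 0 < e \<Longrightarrow> \<exists>d>0. \<forall>h. 0 < h \<and> h < d \<longrightarrow>
      norm (integral {x..x + h} f /\<^sub>R h - f x) < e"
    using integrable_ccontinuous_explicit[of f] f by auto
  obtain N' where N': "negligible N'" "\<And>x e. x \<notin> N' \<Longrightarrow> 0 < e \<Longrightarrow> \<exists>d>0. \<forall>h. 0 < h \<and> h < d \<longrightarrow>
      norm (integral {x..x + h} (\<lambda>x. f (- x)) /\<^sub>R h - f (- x)) < e"
    using integrable_ccontinuous_explicit[of "\<lambda>x. f (- x)"] f' by auto
  \<comment> \<open>Left derivatives may fail on the reflection of \<open>N'\<close>, which is null
    as a differentiable image of a null set.\<close>
  have neg: "negligible (N \<union> uminus ` N')"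
    using N(1) N'(1) by (intro negligible_Un negligible_differentiable_image_negligible)
      (auto intro!: derivative_intros simp: differentiable_on_def)
  have "((\<lambda>t. integral {a..t} f) has_vector_derivative f t) (at t)"
    if "a < t" and t: "t \<notin> N \<union> uminus ` N'" for t
    unfolding has_vector_derivative_def has_derivative_at_alt
  proof (intro conjI allI impI)
    show "bounded_linear (\<lambda>x. x *\<^sub>R f t)" by (rule bounded_linear_scaleR_left)
    fix e :: real assume "e > 0"
    obtain d where "d > 0" and d: "\<And>h. 0 < h \<Longrightarrow> h < d \<Longrightarrow> norm (integral {t..t + h} f /\<^sub>R h - f t) < e"
      using N(2)[of t e] t \<open>e > 0\<close> by auto
    have "- t \<notin> N'" using t by force
    then obtain d' where "d' > 0" and d': "\<And>h. 0 < h \<Longrightarrow> h < d' \<Longrightarrow>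
        norm (integral {-t..-t + h} (\<lambda>x. f (- x)) /\<^sub>R h - f t) < e"
      using N'(2)[of "-t" e] \<open>e > 0\<close> by auto
    \<comment> \<open>A bound on the averaged integral becomes the linear estimate demanded by the
      definition of the derivative.\<close>
    have scale: "norm (I - h *\<^sub>R f t) \<le> e * h" if "norm (I /\<^sub>R h - f t) < e" "h > 0" for I h
    proof -
      have "I - h *\<^sub>R f t = h *\<^sub>R (I /\<^sub>R h - f t)" using \<open>h > 0\<close> by (simp add: scaleR_diff_right)
      then have "norm (I - h *\<^sub>R f t) = h * norm (I /\<^sub>R h - f t)" using \<open>h > 0\<close> by simp
      also have "\<dots> \<le> h * e" using that by (intro mult_left_mono) auto
      finally show ?thesis by (simp add: mult.commute)
    qed
    show "\<exists>r>0. \<forall>y. norm (y - t) < r \<longrightarrow>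
        norm (integral {a..y} f - integral {a..t} f - (y - t) *\<^sub>R f t) \<le> e * norm (y - t)"
    proof (intro exI[of _ "min (min d d') (t - a)"] conjI allI impI)
      show "0 < min (min d d') (t - a)" using \<open>d > 0\<close> \<open>d' > 0\<close> \<open>a < t\<close> by simp
      fix y assume y: "norm (y - t) < min (min d d') (t - a)"
      consider "y = t" | "y > t" | "y < t" by linarith
      then show "norm (integral {a..y} f - integral {a..t} f - (y - t) *\<^sub>R f t) \<le> e * norm (y - t)"
      proof cases
        case 1 then show ?thesis by simp
      next
        case 2
        have "integral {a..y} f - integral {a..t} f = integral {t..y} f"
          using Henstock_Kurzweil_Integration.integral_combine[of a t y f] f 2 \<open>a < t\<close>
          by (simp add: algebra_simps)
        then show ?thesis
          using scale[OF d[of "y - t"]] 2 y by simp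
      next
        case 3
        have "integral {a..t} f - integral {a..y} f = integral {y..t} f"
          using Henstock_Kurzweil_Integration.integral_combine[of a y t f] f 3 y
          by (simp add: algebra_simps)
        then have "integral {a..y} f - integral {a..t} f - (y - t) *\<^sub>R f t = - (integral {y..t} f - (t - y) *\<^sub>R f t)"
          by (simp add: algebra_simps)
        moreover have "integral {-t..-y} (\<lambda>x. f (- x)) = integral {y..t} f"
          by (rule Henstock_Kurzweil_Integration.integral_reflect_real)
        ultimately show ?thesis
          using scale[OF d'[of "t - y"]] 3 y by (simp only: norm_minus_cancel) simp
      qed
    qed
  qed
  then show ?thesis
    unfolding eventually_ae_filter_negligible using neg by blast
qed

subsection \<open>Controls and Caratheodory solutions\<close>

text \<open>Extending \<open>f\<close> by zero to negative arguments makes it integrable on every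
  compact interval, while neither the primitive based at 0 nor the values at positive times
  change.\<close>

lemma half_line_integral_has_vector_derivative_AE:
  fixes f :: "real \<Rightarrow> 'a::euclidean_space"
  assumes f: "\<And>T. T \<ge> 0 \<Longrightarrow> f integrable_on {0..T}"
  shows "AE t in lebesgue. 0 < t \<longrightarrow> ((\<lambda>t. integral {0..t} f) has_vector_derivative f t) (at t)"
proof -
  define g where "g x = (if x \<in> {0..} then f x else 0)" for x
  have "g integrable_on {a..b}" for a b
  proof -
    have "f integrable_on {max 0 a..b}"
      by (rule integrable_on_subinterval[OF f[of "max 0 b"]]) auto
    moreover have "{0..} \<inter> {a..b} = {max 0 a..b}" by auto
    ultimately show ?thesis
      unfolding g_def by (simp only: integrable_restrict_Int)
  qed
  then have "AE t in lebesgue. 0 < t \<longrightarrow> ((\<lambda>t. integral {0..t} g) has_vector_derivative g t) (at t)"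
    by (rule indefinite_integral_has_vector_derivative_AE)
  moreover have "(\<lambda>t. integral {0..t} g) = (\<lambda>t. integral {0..t} f)"
    by (intro ext integral_cong) (auto simp: g_def)
  moreover have "g t = f t" if "0 < t" for t
    using that by (simp add: g_def)
  ultimately show ?thesis by simp
qed

lemma power2_mult_exp:
  fixes r :: real
  shows "(r * exp (k * t))\<^sup>2 = r\<^sup>2 * exp (2 * k * t)"
  by (simp only: power_mult_distrib exp_double mult.assoc)

text \<open>This is Gronwall's inequality: the constraint says that the primitive
  \<open>\<Phi>\<close> of the squared norm satisfies
  \<open>\<Phi>' \<le> \<rho>^2 + 2 * k * \<Phi>\<close> almost everywhere. As \<open>\<Phi>\<close>
  is only absolutely continuous, the comparison goes through
  \<open>abs_continuous_on_mono\<close>.\<close>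

lemma gronwall_constraint_norm_le:
  assumes u: "gronwall_constraint k \<rho> u" and "k > 0" "\<rho> > 0" "t \<ge> 0"
  shows "norm (u t) \<le> \<rho> * exp (k * t)"
proof -
  define \<phi> where "\<phi> s = (norm (u s))\<^sup>2" for s
  define \<Phi> where "\<Phi> s = integral {0..s} \<phi>" for s
  have int: "\<phi> integrable_on {0..s}" and le: "\<phi> s \<le> \<rho>\<^sup>2 + 2 * k * \<Phi> s" if "s \<ge> 0" for s
    using u that unfolding gronwall_constraint_def \<phi>_def \<Phi>_def by auto
  have "\<phi> absolutely_integrable_on {0..t}"
    using int[OF \<open>t \<ge> 0\<close>] by (intro nonnegative_absolutely_integrable_1) (auto simp: \<phi>_def)
  \<comment> \<open>The added constant is chosen so that, after multiplication by
    \<open>exp (- 2 * k * s)\<close>, the derivative contains exactly the slack in the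
    constraint.\<close>
  then have "abs_continuous_on {0..t} (\<lambda>s. \<rho>\<^sup>2 / (2 * k) + \<Phi> s)"
    unfolding \<Phi>_def by (intro abs_continuous_on_add_const abs_continuous_on_indefinite_integral)
  \<comment> \<open>The inner product with \<open>- 1\<close> is a negation: it turns the
    nonincreasing quantity into a nondecreasing one.\<close>
  then have "abs_continuous_on {0..t} (\<lambda>s. (exp ((- 2 * k) * s) *\<^sub>R (\<rho>\<^sup>2 / (2 * k) + \<Phi> s)) \<bullet> (- 1))"
    by (intro abs_continuous_on_inner_right abs_continuous_on_scaleR abs_continuous_on_exp)
  then have ac: "abs_continuous_on {0..t} (\<lambda>s. - (exp (- 2 * k * s) * (\<rho>\<^sup>2 / (2 * k) + \<Phi> s)))"
    by simp
  have "- (exp (- 2 * k * 0) * (\<rho>\<^sup>2 / (2 * k) + \<Phi> 0)) \<le> - (exp (- 2 * k * t) * (\<rho>\<^sup>2 / (2 * k) + \<Phi> t))"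
  proof (rule abs_continuous_on_mono[OF \<open>t \<ge> 0\<close> ac])
    have "AE s in lebesgue. 0 < s \<longrightarrow> (\<Phi> has_vector_derivative \<phi> s) (at s)"
      unfolding \<Phi>_def by (rule half_line_integral_has_vector_derivative_AE[OF int])
    then show "AE s in lebesgue. 0 < s \<and> s < t \<longrightarrow> (\<exists>f'\<ge>0.
        ((\<lambda>s. - (exp (- 2 * k * s) * (\<rho>\<^sup>2 / (2 * k) + \<Phi> s))) has_real_derivative f') (at s))"
    proof (eventually_elim, intro impI)
      fix s assume "0 < s \<longrightarrow> (\<Phi> has_vector_derivative \<phi> s) (at s)" "0 < s \<and> s < t"
      then have "s > 0" "(\<Phi> has_real_derivative \<phi> s) (at s)"
        by (auto simp: has_real_derivative_iff_has_vector_derivative)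
      then have "((\<lambda>s. - (exp (- 2 * k * s) * (\<rho>\<^sup>2 / (2 * k) + \<Phi> s))) has_real_derivative
          exp (- 2 * k * s) * (\<rho>\<^sup>2 + 2 * k * \<Phi> s - \<phi> s)) (at s)"
        using \<open>k > 0\<close> by (auto intro!: derivative_eq_intros simp: field_simps)
      moreover have "exp (- 2 * k * s) * (\<rho>\<^sup>2 + 2 * k * \<Phi> s - \<phi> s) \<ge> 0"
        using le[of s] \<open>s > 0\<close> by simp
      ultimately show "\<exists>f'\<ge>0. ((\<lambda>s. - (exp (- 2 * k * s) * (\<rho>\<^sup>2 / (2 * k) + \<Phi> s))) has_real_derivative f') (at s)"
        by blast
    qed
  qed
  then have le0: "exp (- 2 * k * t) * (\<rho>\<^sup>2 / (2 * k) + \<Phi> t) \<le> \<rho>\<^sup>2 / (2 * k)"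
    by (simp add: \<Phi>_def)
  have "exp (- 2 * k * t) * (\<rho>\<^sup>2 + 2 * k * \<Phi> t) = 2 * k * (exp (- 2 * k * t) * (\<rho>\<^sup>2 / (2 * k) + \<Phi> t))"
    using \<open>k > 0\<close> by (simp add: distrib_left mult.left_commute)
  also have "\<dots> \<le> 2 * k * (\<rho>\<^sup>2 / (2 * k))"
    using \<open>k > 0\<close> by (intro mult_left_mono[OF le0]) simp
  also have "\<dots> = \<rho>\<^sup>2"
    using \<open>k > 0\<close> by simp
  finally have "exp (- 2 * k * t) * (\<rho>\<^sup>2 + 2 * k * \<Phi> t) \<le> \<rho>\<^sup>2" .
  then have "exp (2 * k * t) * (exp (- 2 * k * t) * (\<rho>\<^sup>2 + 2 * k * \<Phi> t)) \<le> exp (2 * k * t) * \<rho>\<^sup>2"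
    by (intro mult_left_mono) simp_all
  moreover have "exp (2 * k * t) * exp (- 2 * k * t) = 1"
    by (simp flip: exp_add)
  ultimately have "\<rho>\<^sup>2 + 2 * k * \<Phi> t \<le> (\<rho> * exp (k * t))\<^sup>2"
    unfolding power2_mult_exp mult.assoc[symmetric, of "exp _"] by (metis mult.commute mult_1)
  then have "(norm (u t))\<^sup>2 \<le> (\<rho> * exp (k * t))\<^sup>2"
    using le[OF \<open>t \<ge> 0\<close>] unfolding \<phi>_def by linarith
  then show ?thesis
    by (rule power2_le_imp_le) (use \<open>\<rho> > 0\<close> in simp)
qed

text \<open>Since \<open>c\<close> is merely integrable, the other factor has to be measurable and
  bounded on \<open>{0..T}\<close>; Gronwall's bound on the control supplies the boundedness. The
  product is the integrand of the variation of constants formula.\<close>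

lemma permissible_control_forcing_absolutely_integrable:
  fixes w :: "real \<Rightarrow> real ^ 'n"
  assumes w: "permissible_control k \<rho> w" and "k > 0" "\<rho> > 0"
    and c: "c absolutely_integrable_on {0..T}"
  shows "(\<lambda>s. c s *\<^sub>R exp (\<alpha> * s) *\<^sub>R w s) absolutely_integrable_on {0..T}"
\<comment> \<open>The arguments of the scalar product are swapped so that the bounded measurable
  factor comes first and the integrable \<open>c\<close> second.\<close>
proof (rule absolutely_integrable_bounded_measurable_product[where h = "\<lambda>x y. y *\<^sub>R x"])
  show "bilinear (\<lambda>(x::real ^ 'n) (y::real). y *\<^sub>R x)"
    by (auto simp: bilinear_def linear_iff algebra_simps)
  have "w \<in> borel_measurable (lebesgue_on {0..T})"
    using w unfolding permissible_control_def by (auto intro: measurable_restrict_mono)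
  moreover have "(\<lambda>s. exp (\<alpha> * s)) \<in> borel_measurable (lebesgue_on {0..T})"
    by (intro continuous_imp_measurable_on_sets_lebesgue continuous_intros) auto
  ultimately show "(\<lambda>s. exp (\<alpha> * s) *\<^sub>R w s) \<in> borel_measurable (lebesgue_on {0..T})"
    by (rule borel_measurable_scaleR[rotated])
  have "bounded ((\<lambda>s. exp (\<alpha> * s) * (\<rho> * exp (k * s))) ` {0..T})"
    by (intro compact_imp_bounded compact_continuous_image continuous_intros compact_Icc)
  then obtain B where "\<forall>y\<in>(\<lambda>s. exp (\<alpha> * s) * (\<rho> * exp (k * s))) ` {0..T}. norm y \<le> B"
    unfolding bounded_iff ..
  then have B: "\<bar>exp (\<alpha> * s) * (\<rho> * exp (k * s))\<bar> \<le> B" if "s \<in> {0..T}" for s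
    using that by simp
  show "bounded ((\<lambda>s. exp (\<alpha> * s) *\<^sub>R w s) ` {0..T})"
    unfolding bounded_iff
  proof (intro exI[of _ B] ballI, clarify)
    fix s assume s: "s \<in> {0..T}"
    have "norm (exp (\<alpha> * s) *\<^sub>R w s) \<le> exp (\<alpha> * s) * (\<rho> * exp (k * s))"
      using gronwall_constraint_norm_le[of k \<rho> w s] w s \<open>k > 0\<close> \<open>\<rho> > 0\<close>
      by (simp add: permissible_control_def)
    also have "\<dots> \<le> B" using B[OF s] by linarith
    finally show "norm (exp (\<alpha> * s) *\<^sub>R w s) \<le> B" .
  qed
qed (use c in auto)

text \<open>Variation of constants gives the solution: \<open>z\<close> is the trajectory formula
  with the factor \<open>exp (- \<alpha> * t)\<close> taken out of the integral. The equation holds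
  wherever the primitive \<open>F\<close> has derivative \<open>f\<close>.\<close>

lemma is_solution_exists:
  fixes w :: "real \<Rightarrow> real ^ 'n"
  assumes w: "permissible_control k \<rho> w" and "k > 0" "\<rho> > 0"
    and c: "\<And>T. T \<ge> 0 \<Longrightarrow> c absolutely_integrable_on {0..T}"
  shows "\<exists>z. is_solution \<alpha> c z0 w z"
proof -
  define f where "f s = c s *\<^sub>R exp (\<alpha> * s) *\<^sub>R w s" for s
  define F where "F t = integral {0..t} f" for t
  define z where "z t = exp ((- \<alpha>) * t) *\<^sub>R (z0 + F t)" for t
  have f: "f absolutely_integrable_on {0..T}" if "T \<ge> 0" for T
    unfolding f_def by (rule permissible_control_forcing_absolutely_integrable[OF w \<open>k > 0\<close> \<open>\<rho> > 0\<close> c[OF that]])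
  have "abs_continuous_on {0..T} z" if "T \<ge> 0" for T
    unfolding z_def F_def using f[OF that]
    by (intro abs_continuous_on_scaleR abs_continuous_on_exp abs_continuous_on_add_const
        abs_continuous_on_indefinite_integral)
  moreover have "z 0 = z0" by (simp add: z_def F_def)
  moreover have "AE t in lebesgue. t > 0 \<longrightarrow> (F has_vector_derivative f t) (at t)"
    unfolding F_def using f
    by (intro half_line_integral_has_vector_derivative_AE) (auto simp: absolutely_integrable_on_def)
  then have "AE t in lebesgue. t > 0 \<longrightarrow>
        (\<exists>z'. (z has_vector_derivative z') (at t) \<and> z' + \<alpha> *\<^sub>R z t = c t *\<^sub>R w t)"
  proof (eventually_elim, intro impI)
    fix t :: real assume "t > 0 \<longrightarrow> (F has_vector_derivative f t) (at t)" "t > 0"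
    then have F: "(F has_vector_derivative f t) (at t)" by blast
    have E: "((\<lambda>t. exp ((- \<alpha>) * t)) has_real_derivative (- \<alpha>) * exp ((- \<alpha>) * t)) (at t)"
      by (auto intro!: derivative_eq_intros)
    have "(z has_vector_derivative exp ((- \<alpha>) * t) *\<^sub>R f t + ((- \<alpha>) * exp ((- \<alpha>) * t)) *\<^sub>R (z0 + F t)) (at t)"
      unfolding z_def
      by (rule has_vector_derivative_scaleR[OF E]) (use F in \<open>auto intro!: derivative_eq_intros\<close>)
    moreover have "exp ((- \<alpha>) * t) *\<^sub>R f t = c t *\<^sub>R w t"
      by (simp add: f_def exp_minus)
    ultimately show "\<exists>z'. (z has_vector_derivative z') (at t) \<and> z' + \<alpha> *\<^sub>R z t = c t *\<^sub>R w t"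
      by (intro exI conjI) (auto simp: z_def)
  qed
  ultimately show ?thesis
    unfolding is_solution_def by blast
qed

text \<open>The integrating factor \<open>exp (\<alpha> * t)\<close> cancels the linear term, so
  only the difference of the controls remains in the derivative. Equal controls yield uniqueness,
  and controls ordered in the direction \<open>b\<close> yield evasion.\<close>

lemma is_solution_difference:
  fixes z1 z2 :: "real \<Rightarrow> real ^ 'n"
  assumes "is_solution \<alpha> c a1 w1 z1" "is_solution \<alpha> c a2 w2 z2"
  shows "abs_continuous_on {0..T} (\<lambda>t. exp (\<alpha> * t) * ((z2 t - z1 t) \<bullet> b))" (is "abs_continuous_on _ ?p")
    and "AE t in lebesgue. t > 0 \<longrightarrow>
      ((\<lambda>t. exp (\<alpha> * t) * ((z2 t - z1 t) \<bullet> b)) has_real_derivative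
        exp (\<alpha> * t) * c t * ((w2 t - w1 t) \<bullet> b)) (at t)"
proof -
  \<comment> \<open>Solutions are absolutely continuous on \<open>{0..T}\<close> for
    \<open>T \<ge> 0\<close>; the maximum also covers negative \<open>T\<close>, where the interval
    is empty.\<close>
  have "abs_continuous_on {0..max 0 T} z1" "abs_continuous_on {0..max 0 T} z2"
    using assms unfolding is_solution_def by (metis max.cobounded1)+
  then have "abs_continuous_on {0..max 0 T} (\<lambda>t. exp (\<alpha> * t) *\<^sub>R ((z2 t - z1 t) \<bullet> b))"
    by (intro abs_continuous_on_scaleR abs_continuous_on_exp abs_continuous_on_inner_right
        abs_continuous_on_diff)
  then show "abs_continuous_on {0..T} ?p"
    by (auto elim: abs_continuous_on_subset)
  have "AE t in lebesgue. t > 0 \<longrightarrow>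
        (\<exists>z'. (z1 has_vector_derivative z') (at t) \<and> z' + \<alpha> *\<^sub>R z1 t = c t *\<^sub>R w1 t)"
    "AE t in lebesgue. t > 0 \<longrightarrow>
        (\<exists>z'. (z2 has_vector_derivative z') (at t) \<and> z' + \<alpha> *\<^sub>R z2 t = c t *\<^sub>R w2 t)"
    using assms unfolding is_solution_def by auto
  then show "AE t in lebesgue. t > 0 \<longrightarrow> (?p has_real_derivative
        exp (\<alpha> * t) * c t * ((w2 t - w1 t) \<bullet> b)) (at t)"
  proof (eventually_elim, intro impI)
    fix t :: real
    assume "t > 0 \<longrightarrow> (\<exists>z'. (z1 has_vector_derivative z') (at t) \<and> z' + \<alpha> *\<^sub>R z1 t = c t *\<^sub>R w1 t)"
      "t > 0 \<longrightarrow> (\<exists>z'. (z2 has_vector_derivative z') (at t) \<and> z' + \<alpha> *\<^sub>R z2 t = c t *\<^sub>R w2 t)" "t > 0"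
    then obtain d1 d2 where d1: "(z1 has_vector_derivative d1) (at t)" "d1 + \<alpha> *\<^sub>R z1 t = c t *\<^sub>R w1 t"
      and d2: "(z2 has_vector_derivative d2) (at t)" "d2 + \<alpha> *\<^sub>R z2 t = c t *\<^sub>R w2 t"
      by blast
    have "((\<lambda>t. (z2 t - z1 t) \<bullet> b) has_vector_derivative (d2 - d1) \<bullet> b) (at t)"
      by (rule bounded_linear.has_vector_derivative[OF bounded_linear_inner_left
            has_vector_derivative_diff[OF d2(1) d1(1)]])
    then have D: "((\<lambda>t. (z2 t - z1 t) \<bullet> b) has_real_derivative (d2 - d1) \<bullet> b) (at t)"
      by (simp add: has_real_derivative_iff_has_vector_derivative)
    have "(?p has_real_derivative exp (\<alpha> * t) * (\<alpha> * ((z2 t - z1 t) \<bullet> b) + (d2 - d1) \<bullet> b)) (at t)"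
      by (rule derivative_eq_intros D refl | simp add: algebra_simps)+
    moreover have "\<alpha> *\<^sub>R (z2 t - z1 t) + (d2 - d1) = c t *\<^sub>R (w2 t - w1 t)"
      using d1(2) d2(2) by (simp add: algebra_simps flip: d1(2) d2(2))
    then have "\<alpha> * ((z2 t - z1 t) \<bullet> b) + (d2 - d1) \<bullet> b = c t * ((w2 t - w1 t) \<bullet> b)"
      by (metis inner_add_left inner_scaleR_left)
    ultimately show "(?p has_real_derivative exp (\<alpha> * t) * c t * ((w2 t - w1 t) \<bullet> b)) (at t)"
      by (simp add: mult.assoc)
  qed
qed

text \<open>With equal controls and equal initial values, every weighted component of the difference
  starts at 0 and has derivative 0 almost everywhere, so it never becomes negative. Testing with the
  negative of the difference itself makes its squared norm at most 0.\<close>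

lemma is_solution_unique:
  assumes z1: "is_solution \<alpha> c a w z1" and z2: "is_solution \<alpha> c a w z2" and "t \<ge> 0"
  shows "z1 t = z2 t"
proof -
  have nonneg: "0 \<le> exp (\<alpha> * t) * ((z2 t - z1 t) \<bullet> b)" for b
  proof -
    have "AE s in lebesgue. 0 < s \<and> s < t \<longrightarrow> (\<exists>f'\<ge>0.
        ((\<lambda>s. exp (\<alpha> * s) * ((z2 s - z1 s) \<bullet> b)) has_real_derivative f') (at s))"
      using is_solution_difference(2)[OF z1 z2, of b] by eventually_elim auto
    then have "exp (\<alpha> * 0) * ((z2 0 - z1 0) \<bullet> b) \<le> exp (\<alpha> * t) * ((z2 t - z1 t) \<bullet> b)"
      by (rule abs_continuous_on_mono[OF \<open>t \<ge> 0\<close> is_solution_difference(1)[OF z1 z2]])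
    then show ?thesis
      using z1 z2 by (simp add: is_solution_def)
  qed
  have "exp (\<alpha> * t) * ((z2 t - z1 t) \<bullet> (z2 t - z1 t)) \<le> 0"
    using nonneg[of "- (z2 t - z1 t)"] by (simp del: minus_diff_eq)
  then have "(z2 t - z1 t) \<bullet> (z2 t - z1 t) \<le> 0"
    by (simp add: mult_le_0_iff)
  then have "z2 t - z1 t = 0"
    using inner_gt_zero_iff[of "z2 t - z1 t"] by (metis not_less)
  then show ?thesis by simp
qed

lemma uniquely_solvable_of_permissible:
  fixes u v :: "real \<Rightarrow> real ^ 'n"
  assumes "permissible_control k \<rho> u" "permissible_control k \<sigma> v" "k > 0" "\<rho> > 0" "\<sigma> > 0"
    and c: "\<And>T. T \<ge> 0 \<Longrightarrow> c absolutely_integrable_on {0..T}"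
  shows "uniquely_solvable \<alpha> c x0 y0 u v"
proof -
  obtain x where x: "is_solution \<alpha> c x0 u x"
    using is_solution_exists[OF assms(1,3,4) c] ..
  obtain y where y: "is_solution \<alpha> c y0 v y"
    using is_solution_exists[OF assms(2,3,5) c] ..
  show ?thesis
    unfolding uniquely_solvable_def is_game_solution_def
  proof (rule exI[of _ x], rule exI[of _ y], intro conjI allI impI)
    show "is_solution \<alpha> c x0 u x" "is_solution \<alpha> c y0 v y" by (fact x, fact y)
    fix x' y' and t :: real
    assume sol: "is_solution \<alpha> c x0 u x' \<and> is_solution \<alpha> c y0 v y'" and "t \<ge> 0"
    show "x' t = x t" "y' t = y t"
      using sol by (auto intro: is_solution_unique[OF _ x \<open>t \<ge> 0\<close>] is_solution_unique[OF _ y \<open>t \<ge> 0\<close>])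
  qed
qed

subsection \<open>Evasion\<close>

text \<open>The squared norm \<open>\<sigma>^2 * exp (2 * k * t)\<close> solves
  \<open>\<phi>' = 2 * k * \<phi>\<close> with \<open>\<phi> 0 = \<sigma>^2\<close>, which is the
  constraint with equality in integrated form.\<close>

lemma exponential_control_permissible:
  assumes "norm e = 1" "k > 0"
  shows "permissible_control k \<sigma> (\<lambda>t. (\<sigma> * exp (k * t)) *\<^sub>R e)"
  unfolding permissible_control_def gronwall_constraint_def
proof (intro conjI allI impI)
  show "(\<lambda>t. (\<sigma> * exp (k * t)) *\<^sub>R e) \<in> borel_measurable (lebesgue_on {0..})"
    by (intro continuous_imp_measurable_on_sets_lebesgue continuous_intros) auto
  have sq: "(norm ((\<sigma> * exp (k * s)) *\<^sub>R e))\<^sup>2 = \<sigma>\<^sup>2 * exp (2 * k * s)" for s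
    unfolding norm_scaleR \<open>norm e = 1\<close> mult_1_right power2_abs by (rule power2_mult_exp)
  fix t :: real assume "t \<ge> 0"
  have "((\<lambda>s. \<sigma>\<^sup>2 * exp (2 * k * s)) has_integral
      \<sigma>\<^sup>2 * exp (2 * k * t) / (2 * k) - \<sigma>\<^sup>2 * exp (2 * k * 0) / (2 * k)) {0..t}"
    by (rule fundamental_theorem_of_calculus[OF \<open>t \<ge> 0\<close>])
      (use \<open>k > 0\<close> in \<open>auto intro!: derivative_eq_intros
        simp: has_real_derivative_iff_has_vector_derivative[symmetric]\<close>)
  then have int: "((\<lambda>s. (norm ((\<sigma> * exp (k * s)) *\<^sub>R e))\<^sup>2) has_integral
      (\<sigma>\<^sup>2 * exp (2 * k * t) - \<sigma>\<^sup>2) / (2 * k)) {0..t}"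
    unfolding sq by (simp add: diff_divide_distrib)
  then show "(\<lambda>s. (norm ((\<sigma> * exp (k * s)) *\<^sub>R e))\<^sup>2) integrable_on {0..t}"
    by blast
  show "(norm ((\<sigma> * exp (k * t)) *\<^sub>R e))\<^sup>2
      \<le> \<sigma>\<^sup>2 + 2 * k * integral {0..t} (\<lambda>s. (norm ((\<sigma> * exp (k * s)) *\<^sub>R e))\<^sup>2)"
    unfolding integral_unique[OF int] unfolding sq using \<open>k > 0\<close> by simp
qed

text \<open>The hypothesis \<open>start\<close> joins distinct and coinciding initial positions, so
  one argument by contradiction serves both: a meeting at time \<open>t\<close> rules out its first
  alternative and leaves the positive integral of \<open>c\<close>.\<close>

lemma exponential_control_evades:
  fixes x y :: "real \<Rightarrow> real ^ 'n"
  assumes "\<rho> > 0" "k > 0" "\<rho> < \<sigma>" and e: "norm e = 1" and "t > 0"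
    and c_nonneg: "\<And>s. s \<ge> 0 \<Longrightarrow> c s \<ge> 0"
    and u: "gronwall_constraint k \<rho> u"
    and x: "is_solution \<alpha> c x0 u x" and y: "is_solution \<alpha> c y0 (\<lambda>t. (\<sigma> * exp (k * t)) *\<^sub>R e) y"
    and start: "(y0 - x0) \<bullet> e > 0 \<or> (y0 - x0) \<bullet> e = 0 \<and> integral {0..t} c > 0"
  shows "x t \<noteq> y t"
proof
  assume eq: "x t = y t"
  define p where "p s = exp (\<alpha> * s) * ((y s - x s) \<bullet> e)" for s
  define q where "q s = ((\<sigma> * exp (k * s)) *\<^sub>R e - u s) \<bullet> e" for s
  \<comment> \<open>Strict positivity serves twice: it makes \<open>p\<close> nondecreasing, and it
    later allows \<open>c s = 0\<close> to be read off from a vanishing derivative of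
    \<open>p\<close>.\<close>
  have q: "q s > 0" if "s > 0" for s
  proof -
    have "u s \<bullet> e \<le> norm (u s)"
      using norm_cauchy_schwarz[of "u s" e] e by simp
    also have "\<dots> \<le> \<rho> * exp (k * s)"
      using gronwall_constraint_norm_le[OF u \<open>k > 0\<close> \<open>\<rho> > 0\<close>, of s] that by simp
    also have "\<dots> < \<sigma> * exp (k * s)"
      using \<open>\<rho> < \<sigma>\<close> by simp
    finally show ?thesis
      using e by (simp add: q_def inner_diff_left norm_eq_1)
  qed
  have ac: "abs_continuous_on {0..T} p" for T
    unfolding p_def by (rule is_solution_difference(1)[OF x y])
  have deriv: "AE s in lebesgue. s > 0 \<longrightarrow> (p has_real_derivative exp (\<alpha> * s) * c s * q s) (at s)"
    unfolding p_def q_def by (rule is_solution_difference(2)[OF x y])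
  then have "AE s in lebesgue. a < s \<and> s < b \<longrightarrow> (\<exists>f'\<ge>0. (p has_real_derivative f') (at s))"
    if "a \<ge> 0" for a b
  proof eventually_elim
    case (elim s)
    show ?case
    proof
      assume "a < s \<and> s < b"
      then have "s > 0" using that by simp
      then have "exp (\<alpha> * s) * c s * q s \<ge> 0" using q[of s] c_nonneg[of s] by simp
      then show "\<exists>f'\<ge>0. (p has_real_derivative f') (at s)" using elim \<open>s > 0\<close> by blast
    qed
  qed
  then have mono: "p a \<le> p b" if "0 \<le> a" "a \<le> b" for a b
    using abs_continuous_on_mono[OF that(2) abs_continuous_on_subset[OF ac[of b]]] that by simp
  have "p 0 = (y0 - x0) \<bullet> e" using x y by (simp add: p_def is_solution_def)
  moreover have "p t = 0" using eq by (simp add: p_def)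
  ultimately have "p 0 = 0" and c: "integral {0..t} c > 0"
    using start mono[of 0 t] \<open>t > 0\<close> by auto
  have p0: "p s = 0" if "0 \<le> s" "s \<le> t" for s
    using mono[OF order_refl that(1)] mono[OF that] \<open>p 0 = 0\<close> \<open>p t = 0\<close> by linarith
  have "AE s in lebesgue. 0 < s \<and> s < t \<longrightarrow> c s = 0"
    using deriv
  proof eventually_elim
    case (elim s)
    show ?case
    proof
      assume s: "0 < s \<and> s < t"
      \<comment> \<open>On the open interval \<open>p\<close> agrees with the zero function, so its
        derivative formula must give 0.\<close>
      have "((\<lambda>_. 0) has_real_derivative exp (\<alpha> * s) * c s * q s) (at s)"
      proof (rule has_field_derivative_transform_within_open)
        show "(p has_real_derivative exp (\<alpha> * s) * c s * q s) (at s)" using elim s by blast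
        show "p r = 0" if "r \<in> {0<..<t}" for r using p0[of r] that by simp
      qed (use s in auto)
      then have "exp (\<alpha> * s) * c s * q s = 0"
        by (rule DERIV_unique[OF _ DERIV_const])
      then show "c s = 0" using q[of s] s by simp
    qed
  qed
  then obtain N where "negligible N" and N: "\<And>s. s \<notin> N \<Longrightarrow> 0 < s \<and> s < t \<longrightarrow> c s = 0"
    unfolding eventually_ae_filter_negligible by blast
  \<comment> \<open>The vanishing of \<open>c\<close> is known only strictly inside the interval, so
    both endpoints join the exceptional null set.\<close>
  have "integral {0..t} c = integral {0..t} (\<lambda>_. 0)"
    by (rule integral_spike[where S = "insert 0 (insert t N)"]) (use \<open>negligible N\<close> N in \<open>auto simp: less_le\<close>)
  with c show False by simp
qed

text \<open>Local integrability of \<open>c\<close> gives meaning to the trajectory integrals. The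
  assumption \<open>nondegenerate\<close> concerns a common starting point: if \<open>c\<close>
  vanished almost everywhere on some \<open>{0..t}\<close>, both players would follow the same
  uncontrolled motion there and evasion would be impossible.\<close>

theorem theorem3p5:
  fixes \<rho> \<sigma> k \<alpha> :: real and c :: "real \<Rightarrow> real" and x0 y0 :: "real ^ 'n"
  assumes "\<rho> > 0" "\<sigma> > 0" "k > 0" "\<alpha> \<noteq> 0"
    and c_nonneg: "\<forall>t\<ge>0. c t \<ge> 0"
    and c_locally_integrable: "\<forall>T\<ge>0. c absolutely_integrable_on {0..T}"
    and nondegenerate: "x0 = y0 \<longrightarrow> (\<forall>t>0. integral {0..t} c > 0)"
    and "\<rho> < \<sigma>"
  shows "\<exists>V. evader_strategy \<alpha> c \<rho> \<sigma> k V \<and> permissible_strategy k \<sigma> V \<and>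
           (\<forall>u. permissible_control k \<rho> u \<longrightarrow>
              (\<forall>x y. is_game_solution \<alpha> c x0 y0 u (V x0 y0) x y \<longrightarrow> (\<forall>t>0. x t \<noteq> y t)))"
proof -
  \<comment> \<open>A strategy is defined for all initial pairs, so a direction is needed for
    \<open>a = b\<close> too; there a unit vector along an arbitrary coordinate serves.\<close>
  define e :: "real ^ 'n \<Rightarrow> real ^ 'n \<Rightarrow> real ^ 'n"
    where "e a b = (if a = b then axis undefined 1 else sgn (b - a))" for a b
  define V where "V a b t = (\<sigma> * exp (k * t)) *\<^sub>R e a b" for a b t
  have e: "norm (e a b) = 1" for a b
    by (simp add: e_def norm_sgn norm_axis_1)
  have V: "permissible_control k \<sigma> (V a b)" for a b
    unfolding V_def by (rule exponential_control_permissible[OF e \<open>k > 0\<close>])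
  show ?thesis
  proof (intro exI[of _ V] conjI allI impI)
    show "permissible_strategy k \<sigma> V"
      using V by (simp add: permissible_strategy_def)
    show "evader_strategy \<alpha> c \<rho> \<sigma> k V"
      unfolding evader_strategy_def
    proof (intro allI conjI impI)
      show "uniquely_solvable \<alpha> c a b u (V a b)" if "permissible_control k \<rho> u" for a b u
        using c_locally_integrable
        by (intro uniquely_solvable_of_permissible[OF that V \<open>k > 0\<close> \<open>\<rho> > 0\<close> \<open>\<sigma> > 0\<close>]) blast
      show "gronwall_constraint k \<sigma> (V a b)" for a b
        using V by (simp add: permissible_control_def)
    qed
    fix u x y and t :: real
    assume u: "permissible_control k \<rho> u" and xy: "is_game_solution \<alpha> c x0 y0 u (V x0 y0) x y" and "t > 0"
    have "(y0 - x0) \<bullet> e x0 y0 > 0 \<or> (y0 - x0) \<bullet> e x0 y0 = 0 \<and> integral {0..t} c > 0"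
    proof (cases "x0 = y0")
      case True then show ?thesis using nondegenerate \<open>t > 0\<close> by simp
    next
      \<comment> \<open>Here the inner product with the normalized difference is the initial
        distance, which is positive.\<close>
      case False
      then show ?thesis
        by (simp add: e_def sgn_div_norm inner_scaleR_right)
    qed
    then show "x t \<noteq> y t"
      using u xy c_nonneg unfolding is_game_solution_def V_def permissible_control_def
      by (intro exponential_control_evades[OF \<open>\<rho> > 0\<close> \<open>k > 0\<close> \<open>\<rho> < \<sigma>\<close> e \<open>t > 0\<close>, of c]) auto
  qed
qed

end
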